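(* For every real $R\ge 1$ and every real $\epsilon$ with $0<\epsilon<1$, the competitive ratio of the proportional\&removable online knapsack problem with a buffer of capacity $R$ is at least $1+\frac{1}{\lceil 2R\rceil+1}-\epsilon$.
   Context: Online knapsack problem with a resource buffer: there is a knapsack of capacity $1$ and a buffer of capacity $R\ge 1$. Items $e_1,\dots,e_n$ arrive one by one; each item $e$ has size $0<s(e)\le 1$ and value $v(e)\ge 0$; $s(B),v(B)$ denote sums over a set $B$. A deterministic online algorithm maintains buffer contents $B_0=\emptyset,B_1,\dots,B_n$, with $B_i$ chosen after seeing only $e_1,\dots,e_i$, $B_i\subseteq B_{i-1}\cup\{e_i\}$ and $s(B_i)\le R$ (removable setting). $\mathrm{ALG}(I)=\max\{v(B)\mid B\subseteq B_n,\ s(B)\le 1\}$, $\mathrm{OPT}(I)=\max\{v(B)\mid B\subseteq\{e_1,\dots,e_n\},\ s(B)\le 1\}$. "Proportional" means $v(e)=s(e)$ for every item. The competitive ratio of an algorithm is $\sup_I \mathrm{OPT}(I)/\mathrm{ALG}(I)$ (with $a/0=\infty$ for $a>0$), and the competitive ratio of the problem is the infimum of this over all deterministic online algorithms. *)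

theory Defs
  imports Complex_Main "HOL-Library.Extended_Real"
begin

record item =
  item_size :: real
  item_value :: real

text \<open>
  An instance is the list of its items in order of arrival. Items are identified by their
  0-based position in this list, so that several items may have the same size and value;
  sets of items (such as buffer contents) are sets of positions.
\<close>

definition size_of :: "item list \<Rightarrow> nat set \<Rightarrow> real" where
  "size_of I B = (\<Sum>i\<in>B. item_size (I ! i))"

definition value_of :: "item list \<Rightarrow> nat set \<Rightarrow> real" where
  "value_of I B = (\<Sum>i\<in>B. item_value (I ! i))"

definition instances :: "item list set" where
  "instances = {I. \<forall>e\<in>set I. 0 < item_size e \<and> item_size e \<le> 1 \<and> 0 \<le> item_value e}"

definition proportional_instances :: "item list set" where
  "proportional_instances = {I \<in> instances. \<forall>e\<in>set I. item_value e = item_size e}"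

text \<open>
  A deterministic online algorithm maps the list of items seen so far to the current buffer
  contents: on the instance \<open>I\<close> its \<open>i\<close>-th buffer is \<open>A (take i I)\<close>.
  The algorithm is only constrained on the prefix-closed class \<open>C\<close> of instances it may be
  confronted with. The item \<open>e\<close> arriving after \<open>I\<close> has position \<open>length I\<close>.
\<close>

definition removable_online_algorithm ::
    "real \<Rightarrow> item list set \<Rightarrow> (item list \<Rightarrow> nat set) \<Rightarrow> bool" where
  "removable_online_algorithm R C A \<longleftrightarrow>
     A [] = {} \<and>
     (\<forall>I e. I @ [e] \<in> C \<longrightarrow>
        A (I @ [e]) \<subseteq> A I \<union> {length I} \<and> size_of (I @ [e]) (A (I @ [e])) \<le> R)"

definition best_packing :: "item list \<Rightarrow> nat set \<Rightarrow> real" where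
  "best_packing I S = Max {value_of I B | B. B \<subseteq> S \<and> size_of I B \<le> 1}"

definition ALG :: "(item list \<Rightarrow> nat set) \<Rightarrow> item list \<Rightarrow> real" where
  "ALG A I = best_packing I (A I)"

definition OPT :: "item list \<Rightarrow> real" where
  "OPT I = best_packing I {..<length I}"

text \<open>
  Division on \<^typ>\<open>ereal\<close> satisfies \<open>a / 0 = \<infinity>\<close> for \<open>a > 0\<close>, and \<open>0 / 0 = 0\<close>. The latter
  arises only when the optimum is \<open>0\<close> and does not influence the supremum over the
  proportional instances, since every nonempty one has ratio at least \<open>1\<close>.
\<close>

definition algorithm_ratio :: "item list set \<Rightarrow> (item list \<Rightarrow> nat set) \<Rightarrow> ereal" where
  "algorithm_ratio C A = (SUP I\<in>C. ereal (OPT I) / ereal (ALG A I))"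

definition removable_competitive_ratio :: "real \<Rightarrow> item list set \<Rightarrow> ereal" where
  "removable_competitive_ratio R C =
     (INF A\<in>{A. removable_online_algorithm R C A}. algorithm_ratio C A)"

end

theory Submission
  imports Defs
begin

text \<open>
  Put \<open>k = \<lceil>2R\<rceil> + 1\<close>. The adversary presents items of sizes \<open>j/(k+1) + \<delta>\<close> for
  \<open>j = 1, \<dots>, k\<close>. Their total size exceeds \<open>k/2 > R\<close>, so some item \<open>i\<close> is missing from the
  buffer afterwards, and the adversary presents its complement \<open>1 - i/(k+1) - \<delta>\<close>. Now the
  optimum is \<open>1\<close>. Up to multiples of \<open>\<delta>\<close>, every packing has size \<open>N/(k+1)\<close> with \<open>N\<close> an
  integer. A packing from the buffer with \<open>N = k + 1\<close> uses either no complement, or the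
  complement and at least two further items, since item \<open>i\<close> is gone; either way the excess
  is a positive multiple of \<open>\<delta>\<close>, so it does not fit. Hence the algorithm gets at most about
  \<open>k/(k+1)\<close>.
\<close>

section \<open>Proportional instances and the buffers of an online algorithm\<close>

definition prop_item :: "real \<Rightarrow> item" where
  "prop_item x = \<lparr>item_size = x, item_value = x\<rparr>"

lemma prop_item_simps [simp]:
  "item_size (prop_item x) = x" "item_value (prop_item x) = x"
  by (simp_all add: prop_item_def)

lemma proportional_instances_map_prop_item:
  assumes "\<And>x. x \<in> set xs \<Longrightarrow> 0 < x \<and> x \<le> 1"
  shows "map prop_item xs \<in> proportional_instances"
  using assms by (force simp: proportional_instances_def instances_def)

lemma proportional_instances_butlast:
  "I @ [e] \<in> proportional_instances \<Longrightarrow> I \<in> proportional_instances"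
  by (auto simp: proportional_instances_def instances_def)

text \<open>An algorithm is constrained only on instances of the class, so the induction relies on
  prefixes staying proportional.\<close>

lemma buffer_subset:
  assumes "removable_online_algorithm R proportional_instances A"
    and "I \<in> proportional_instances"
  shows "A I \<subseteq> {..<length I}"
  using assms(2)
proof (induction I rule: rev_induct)
  case Nil
  then show ?case using assms(1) by (simp add: removable_online_algorithm_def)
next
  case (snoc e I)
  then have "A (I @ [e]) \<subseteq> A I \<union> {length I}"
    using assms(1) by (simp add: removable_online_algorithm_def)
  then show ?case
    using snoc.IH[OF proportional_instances_butlast[OF snoc.prems]] by fastforce
qed

lemma buffer_size_le:
  assumes "removable_online_algorithm R C A" and "I \<in> C" and "I \<noteq> []"
  shows "size_of I (A I) \<le> R"
  using assms by (cases I rule: rev_cases) (auto simp: removable_online_algorithm_def)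

section \<open>Bounds for the best packing\<close>

lemma finite_packing_values:
  "finite S \<Longrightarrow> finite {value_of I B | B. B \<subseteq> S \<and> size_of I B \<le> 1}"
  by (rule finite_subset[of _ "value_of I ` Pow S"]) auto

lemma best_packing_ge:
  assumes "finite S" "B \<subseteq> S" "size_of I B \<le> 1"
  shows "value_of I B \<le> best_packing I S"
  unfolding best_packing_def using assms by (intro Max_ge finite_packing_values) auto

lemma best_packing_le:
  assumes "finite S" "\<And>B. B \<subseteq> S \<Longrightarrow> size_of I B \<le> 1 \<Longrightarrow> value_of I B \<le> b"
  shows "best_packing I S \<le> b"
  unfolding best_packing_def
proof (rule Max.boundedI)
  have "size_of I {} \<le> 1" by (simp add: size_of_def)
  then show "{value_of I B |B. B \<subseteq> S \<and> size_of I B \<le> 1} \<noteq> {}" by blast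
qed (use assms finite_packing_values in auto)

lemma best_packing_nonneg:
  assumes "finite S"
  shows "0 \<le> best_packing I S"
  using best_packing_ge[OF assms, of "{}" I] by (simp add: size_of_def value_of_def)

section \<open>The sizes of the first \<open>k\<close> items\<close>

definition staircase :: "nat \<Rightarrow> real \<Rightarrow> real list" where
  "staircase k \<delta> = map (\<lambda>j. real (Suc j) / real (Suc k) + \<delta>) [0..<k]"

lemma length_staircase [simp]: "length (staircase k \<delta>) = k"
  by (simp add: staircase_def)

lemma nth_staircase [simp]:
  "j < k \<Longrightarrow> staircase k \<delta> ! j = real (Suc j) / real (Suc k) + \<delta>"
  by (simp add: staircase_def)

text \<open>Positions start at 0, so position \<open>j\<close> has numerator \<open>j + 1\<close>
  and the largest size is \<open>k/(k+1) + \<delta>\<close>. The strict upper bound makes every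
  complement a legal item of positive size.\<close>

lemma staircase_bounds:
  assumes "0 < \<delta>" "\<delta> < 1 / real (Suc k)" "j < k"
  shows "0 < staircase k \<delta> ! j" "staircase k \<delta> ! j < 1"
proof -
  show "0 < staircase k \<delta> ! j" using assms by (simp add: add_nonneg_pos)
  have "staircase k \<delta> ! j < real (Suc j) / real (Suc k) + 1 / real (Suc k)"
    using assms by simp
  also have "\<dots> = real (Suc j + 1) / real (Suc k)" by (simp add: add_divide_distrib)
  also have "\<dots> \<le> 1" using assms by simp
  finally show "staircase k \<delta> ! j < 1" .
qed

lemma sum_staircase:
  assumes "B \<subseteq> {..<k}"
  shows "(\<Sum>j\<in>B. staircase k \<delta> ! j) = real (\<Sum>j\<in>B. Suc j) / real (Suc k) + real (card B) * \<delta>"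
proof -
  have "(\<Sum>j\<in>B. staircase k \<delta> ! j) = (\<Sum>j\<in>B. real (Suc j) / real (Suc k) + \<delta>)"
    using assms by (intro sum.cong) auto
  then show ?thesis by (simp only: sum.distrib sum_divide_distrib of_nat_sum sum_constant)
qed

lemma sum_staircase_all: "(\<Sum>j<k. staircase k \<delta> ! j) = real k / 2 + real k * \<delta>"
proof -
  have "real (\<Sum>j<k. Suc j) = real k * real (Suc k) / 2"
    by (induction k) (auto simp: field_simps)
  then show ?thesis
    unfolding sum_staircase[OF order.refl] by (simp del: of_nat_Suc)
qed

text \<open>The rounding step: a positive excess pushes the fraction strictly below 1, and an
  integer numerator below \<open>k + 1\<close> is at most \<open>k\<close>.\<close>

lemma numerator_le:
  fixes N k :: nat and \<delta> r :: real
  assumes "real N / real (Suc k) + r * \<delta> \<le> 1" "0 < \<delta>" "0 < r"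
  shows "N \<le> k"
proof -
  have "real N / real (Suc k) < 1" using assms mult_pos_pos[of r \<delta>] by linarith
  then show ?thesis by (simp add: divide_less_eq)
qed

section \<open>Packings that lack the partner of the last item\<close>

definition trap :: "nat \<Rightarrow> real \<Rightarrow> nat \<Rightarrow> real list" where
  "trap k \<delta> i = staircase k \<delta> @ [1 - staircase k \<delta> ! i]"

lemma packing_without_partner:
  assumes \<delta>: "0 < \<delta>" and i: "i < k" and B: "B \<subseteq> {..k}" "i \<notin> B"
    and fits: "(\<Sum>j\<in>B. trap k \<delta> i ! j) \<le> 1"
  shows "(\<Sum>j\<in>B. trap k \<delta> i ! j) \<le> real k / real (Suc k) + real k * \<delta>"
proof -
  \<comment> \<open>Position \<open>k\<close> holds the complement; \<open>C\<close> is the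
    staircase part of the packing and \<open>M\<close> its numerator.\<close>
  define C where "C = B - {k}"
  define M where "M = (\<Sum>j\<in>C. Suc j)"
  have C: "C \<subseteq> {..<k}" "i \<notin> C" "finite C"
    using B by (auto simp: C_def intro: finite_subset)
  have card: "card C \<le> k" using card_mono[OF _ C(1)] by simp
  have sum_C: "(\<Sum>j\<in>C. trap k \<delta> i ! j) = real M / real (Suc k) + real (card C) * \<delta>"
  proof -
    have "(\<Sum>j\<in>C. trap k \<delta> i ! j) = (\<Sum>j\<in>C. staircase k \<delta> ! j)"
      using C by (intro sum.cong) (auto simp: trap_def nth_append)
    then show ?thesis unfolding M_def using sum_staircase[OF C(1)] by simp
  qed
  \<comment> \<open>The coefficient \<open>r\<close> is real because it equals -1 when the
    complement is packed alone.\<close>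
  have "\<exists>N r. (\<Sum>j\<in>B. trap k \<delta> i ! j) = real N / real (Suc k) + r * \<delta> \<and> N \<le> k \<and> r \<le> real k"
  proof (cases "k \<in> B")
    case False
    then have "B = C" by (auto simp: C_def)
    have "M \<le> k"
    \<comment> \<open>The empty packing has no excess, so the rounding step does not apply to it;
      its numerator is 0.\<close>
    proof (cases "C = {}")
      case True
      then show ?thesis by (simp add: M_def)
    next
      case False
      then have "0 < real (card C)" using C by (simp add: card_gt_0_iff)
      then show ?thesis using numerator_le fits sum_C \<delta> \<open>B = C\<close> by metis
    qed
    then show ?thesis using sum_C card \<open>B = C\<close> by (metis of_nat_le_iff)
  next
    case True
    then have "B = insert k C" "k \<notin> C" by (auto simp: C_def)
    then have "(\<Sum>j\<in>B. trap k \<delta> i ! j)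
        = trap k \<delta> i ! k + (real M / real (Suc k) + real (card C) * \<delta>)"
      using C sum_C by simp
    \<comment> \<open>The numerator is \<open>(k + 1) - (i + 1)\<close>; the excess -\<delta>
      cancels that of one staircase item.\<close>
    also have "trap k \<delta> i ! k = real (k - i) / real (Suc k) - \<delta>"
      using i by (simp add: trap_def nth_append of_nat_diff field_simps)
    finally have sum_B: "(\<Sum>j\<in>B. trap k \<delta> i ! j)
        = real (M + (k - i)) / real (Suc k) + (real (card C) - 1) * \<delta>"
      by (simp add: add_divide_distrib algebra_simps)
    \<comment> \<open>The net excess \<open>card C - 1\<close> is negative, zero or positive; only
      the last case allows rounding.\<close>
    consider "card C = 0" | "card C = 1" | "2 \<le> card C" by linarith
    then have "M + (k - i) \<le> k"
    proof cases
      case 1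
      then have "C = {}" using C by simp
      then show ?thesis by (simp add: M_def)
    next
      case 2
      then obtain j where j: "C = {j}" by (auto simp: card_1_singleton_iff)
      \<comment> \<open>Without excess, numerator \<open>k + 1\<close> is not ruled out by size, but
        it would force \<open>j = i\<close>, the missing item.\<close>
      have "real (M + (k - i)) / real (Suc k) \<le> 1" using fits sum_B 2 by simp
      then have "M + (k - i) \<le> Suc k" by (simp add: divide_le_eq del: of_nat_add)
      moreover have "M = Suc j" "j \<noteq> i" using j C by (auto simp: M_def)
      ultimately show ?thesis using i by linarith
    next
      case 3
      then have "0 < real (card C) - 1" by linarith
      then show ?thesis using numerator_le fits sum_B \<delta> by metis
    qed
    then show ?thesis using sum_B card
      by (intro exI[of _ "M + (k - i)"] exI[of _ "real (card C) - 1"]) auto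
  qed
  then obtain N r where
    "(\<Sum>j\<in>B. trap k \<delta> i ! j) = real N / real (Suc k) + r * \<delta>" "N \<le> k" "r \<le> real k"
    by blast
  then show ?thesis using \<delta> by (auto intro!: add_mono divide_right_mono mult_right_mono)
qed

section \<open>The adversary against a given algorithm\<close>

lemma of_map_prop_item:
  assumes "B \<subseteq> {..<length xs}"
  shows "size_of (map prop_item xs) B = (\<Sum>j\<in>B. xs ! j)"
    and "value_of (map prop_item xs) B = (\<Sum>j\<in>B. xs ! j)"
  unfolding size_of_def value_of_def using assms by (auto intro!: sum.cong)

text \<open>The algorithm is deterministic, so the last item can be chosen by inspecting its buffer
  after the staircase. If \<open>R = k/2\<close>, the extra \<open>k * \<delta>\<close> still makes
  the staircase overflow the buffer.\<close>

lemma adversary: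
  assumes A: "removable_online_algorithm R proportional_instances A"
    and k: "0 < k" "R \<le> real k / 2" and \<delta>: "0 < \<delta>" "\<delta> < 1 / real (Suc k)"
  obtains I where "I \<in> proportional_instances" "1 \<le> OPT I"
    "0 \<le> ALG A I" "ALG A I \<le> real k / real (Suc k) + real k * \<delta>"
proof -
  define J where "J = map prop_item (staircase k \<delta>)"
  have J: "J \<in> proportional_instances" unfolding J_def
    by (rule proportional_instances_map_prop_item)
      (use staircase_bounds[OF \<delta>] in \<open>force simp: in_set_conv_nth\<close>)
  have len_J: "length J = k" by (simp add: J_def)
  have buf_J: "A J \<subseteq> {..<k}" using buffer_subset[OF A J] len_J by simp
  have "A J \<noteq> {..<k}"
  proof
    assume "A J = {..<k}"
    then have "size_of J (A J) = real k / 2 + real k * \<delta>"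
      unfolding J_def by (simp add: of_map_prop_item sum_staircase_all del: nth_staircase)
    moreover have "size_of J (A J) \<le> R"
      using buffer_size_le[OF A J] len_J k by force
    moreover have "0 < real k * \<delta>" using k \<delta> by simp
    ultimately show False using k by linarith
  qed
  then obtain i where i: "i < k" "i \<notin> A J" using buf_J by blast
  define I where "I = map prop_item (trap k \<delta> i)"
  have I_snoc: "I = J @ [prop_item (1 - staircase k \<delta> ! i)]"
    by (simp add: I_def J_def trap_def)
  have len_I: "length (trap k \<delta> i) = Suc k" "length I = Suc k"
    by (simp_all add: I_def trap_def)
  have I: "I \<in> proportional_instances" unfolding I_def
    by (rule proportional_instances_map_prop_item)
      (use staircase_bounds[OF \<delta>] i in \<open>force simp: trap_def in_set_conv_nth\<close>)
  \<comment> \<open>A discarded item cannot return: the last step can add only position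
    \<open>k\<close>.\<close>
  have "A I \<subseteq> A J \<union> {k}"
    using A I unfolding I_snoc removable_online_algorithm_def len_J[symmetric] by blast
  then have buf_I: "A I \<subseteq> {..k}" "i \<notin> A I" using buf_J i by auto
  then have fin: "finite (A I)" by (auto intro: finite_subset)
  have "ALG A I \<le> real k / real (Suc k) + real k * \<delta>"
    unfolding ALG_def
  proof (rule best_packing_le[OF fin])
    fix B assume "B \<subseteq> A I" and fits: "size_of I B \<le> 1"
    then have B: "B \<subseteq> {..k}" "i \<notin> B" using buf_I by auto
    then have "B \<subseteq> {..<length (trap k \<delta> i)}" using len_I by auto
    note sums = of_map_prop_item[OF this, folded I_def]
    show "value_of I B \<le> real k / real (Suc k) + real k * \<delta>"
      using packing_without_partner[OF \<delta>(1) i(1) B] fits sums by simp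
  qed
  moreover have "0 \<le> ALG A I" unfolding ALG_def using best_packing_nonneg[OF fin] .
  moreover have "1 \<le> OPT I"
  proof -
    have "{i, k} \<subseteq> {..<length (trap k \<delta> i)}" using i len_I by auto
    note sums = of_map_prop_item[OF this, folded I_def]
    have "(\<Sum>j\<in>{i, k}. trap k \<delta> i ! j) = 1"
      using i by (simp add: trap_def nth_append)
    then show ?thesis
      using best_packing_ge[of "{..<length I}" "{i, k}" I] sums i len_I by (simp add: OPT_def)
  qed
  ultimately show thesis using that I by blast
qed

section \<open>From the packing bound to the ratio\<close>

lemma ereal_le_divide:
  fixes a b c :: real
  assumes "0 \<le> a" "0 < b" "c * a \<le> b"
  shows "ereal c \<le> ereal b / ereal a"
proof (cases "a = 0")
  case True
  then show ?thesis using assms by (simp add: divide_ereal_def)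
next
  case False
  then show ?thesis using assms by (simp add: pos_le_divide_eq)
qed

theorem theorem17:
  fixes R \<epsilon> :: real
  assumes "R \<ge> 1" and "0 < \<epsilon>" and "\<epsilon> < 1"
  shows "removable_competitive_ratio R proportional_instances
           \<ge> ereal (1 + 1 / (real_of_int \<lceil>2 * R\<rceil> + 1) - \<epsilon>)"
  unfolding removable_competitive_ratio_def
proof (rule INF_greatest)
  fix A assume "A \<in> {A. removable_online_algorithm R proportional_instances A}"
  then have A: "removable_online_algorithm R proportional_instances A" by simp
  define k where "k = nat (\<lceil>2 * R\<rceil> + 1)"
  define c where "c = 1 + 1 / real k - \<epsilon>"
  \<comment> \<open>Since \<open>c \<le> 2\<close>, the \<delta>-term in the bound on
    \<open>c * ALG A I\<close> costs at most \<open>2 * k * \<delta>\<close>, and this choice makes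
    that equal to the slack \<open>\<epsilon> * k/(k+1)\<close>.\<close>
  define \<delta> where "\<delta> = \<epsilon> / (2 * real (Suc k))"
  have "0 \<le> \<lceil>2 * R\<rceil>" using assms by simp
  then have real_k: "real k = real_of_int \<lceil>2 * R\<rceil> + 1" by (simp add: k_def)
  then have k: "0 < k" "R \<le> real k / 2" using assms by (auto simp: k_def) linarith
  have "\<delta> = (\<epsilon> / 2) / real (Suc k)" by (simp add: \<delta>_def)
  also have "\<dots> < 1 / real (Suc k)" using assms by (intro divide_strict_right_mono) auto
  finally have \<delta>: "0 < \<delta>" "\<delta> < 1 / real (Suc k)" using assms by (simp_all add: \<delta>_def)
  obtain I where I: "I \<in> proportional_instances" "1 \<le> OPT I" "0 \<le> ALG A I"
    "ALG A I \<le> real k / real (Suc k) + real k * \<delta>"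
    using adversary[OF A k \<delta>] by blast
  have "0 \<le> 1 / real k" "1 / real k \<le> 1" using k by simp_all
  then have c: "0 < c" "c \<le> 2" using assms by (simp_all only: c_def)
  \<comment> \<open>Here \<open>c = (k+1)/k - \<epsilon>\<close>, whose first summand is the
    reciprocal of \<open>k/(k+1)\<close>.\<close>
  have "c * (real k / real (Suc k) + real k * \<delta>)
      = 1 - \<epsilon> * (real k / real (Suc k)) + c * (real k * \<delta>)"
    using k by (simp add: c_def field_simps)
  also have "c * (real k * \<delta>) \<le> 2 * (real k * \<delta>)"
    using c \<delta> by (intro mult_right_mono) auto
  also have "2 * (real k * \<delta>) = \<epsilon> * (real k / real (Suc k))"
    by (simp add: \<delta>_def del: of_nat_Suc)
  finally have "c * (real k / real (Suc k) + real k * \<delta>) \<le> 1" by simp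
  moreover have "c * ALG A I \<le> c * (real k / real (Suc k) + real k * \<delta>)"
    using c I by (intro mult_left_mono) auto
  ultimately have "c * ALG A I \<le> OPT I" using I by linarith
  \<comment> \<open>The product form also covers \<open>ALG A I = 0\<close>, where the quotient is
    infinite because \<open>OPT I\<close> is positive.\<close>
  then have "ereal c \<le> ereal (OPT I) / ereal (ALG A I)"
    using I by (intro ereal_le_divide) auto
  also have "\<dots> \<le> algorithm_ratio proportional_instances A"
    unfolding algorithm_ratio_def using I(1) by (rule SUP_upper)
  finally show "ereal (1 + 1 / (real_of_int \<lceil>2 * R\<rceil> + 1) - \<epsilon>)
      \<le> algorithm_ratio proportional_instances A"
    by (simp add: c_def real_k)
qed

end
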